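(* Let $l>0$, let $\gamma\colon[0,l]\to\mathbb{R}^3$ be a $C^3$ unit-speed curve with curvature $\kappa>0$ everywhere and torsion $\tau$, and let $$E(\theta)=\int_0^l \frac{\left(\kappa^2\cos^2\theta+(\theta'+\tau)^2\right)^2}{\kappa^2\cos^2\theta}\,dt\in[0,+\infty],\qquad \theta\in W^{1,4}([0,l]).$$ Suppose that the torsion $\tau$ is a constant function satisfying $$|\tau|>n\frac{\pi}{l}+\max_{t\in[0,l]}|\kappa(t)|\quad\text{for some } n\in\mathbb{N}_0=\{0,1,2,\dots\}.$$ Then any minimizer $\theta_{\min}$ of $E$ in $W^{1,4}([0,l])$ has at least $n$ singular points, i.e., there are at least $n$ distinct points $t\in[0,l]$ with $\theta_{\min}(t)\in\frac{\pi}{2}+\pi\mathbb{Z}$.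
   Context: The integrand of $E$ is understood to be $0$ at any point $t$ where both the numerator and the denominator vanish, and $+\infty$ at any point where the denominator vanishes but the numerator does not. Here $\kappa\in C^1([0,l],\mathbb{R}_{>0})$. $W^{1,4}([0,l])$ is the real-valued Sobolev space of functions on $(0,l)$ with weak derivative in $L^4$; each element is identified with its continuous representative on $[0,l]$. A minimizer of $E$ in $W^{1,4}([0,l])$ is a $\theta_{\min}\in W^{1,4}([0,l])$ with $E(\theta_{\min})\le E(\theta)$ for all $\theta\in W^{1,4}([0,l])$. A point $t\in[0,l]$ is a singular point of $\theta\in W^{1,4}([0,l])$ if $\theta(t)\in\frac{\pi}{2}+\pi\mathbb{Z}$. *)

theory Defs
  imports "HOL-Analysis.Analysis" "HOL-Analysis.Cross3"
begin

text \<open>Curves on \<open>[0,l]\<close>. Derivatives are taken relative to \<open>{0..l}\<close>, hence are one-sided at the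
  two endpoints; the values of a curve outside \<open>{0..l}\<close> are irrelevant.\<close>

definition vderiv :: "real \<Rightarrow> (real \<Rightarrow> 'a::real_normed_vector) \<Rightarrow> real \<Rightarrow> 'a" where
  "vderiv l f = (\<lambda>t. vector_derivative f (at t within {0..l}))"

definition Ck_curve :: "nat \<Rightarrow> real \<Rightarrow> (real \<Rightarrow> 'a::real_normed_vector) \<Rightarrow> bool" where
  "Ck_curve k l f \<longleftrightarrow>
     (\<forall>j<k. (vderiv l ^^ j) f differentiable_on {0..l}) \<and>
     continuous_on {0..l} ((vderiv l ^^ k) f)"

definition unit_speed :: "real \<Rightarrow> (real \<Rightarrow> real^3) \<Rightarrow> bool" where
  "unit_speed l \<gamma> \<longleftrightarrow> (\<forall>t\<in>{0..l}. norm (vderiv l \<gamma> t) = 1)"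

text \<open>Frenet apparatus of a unit-speed curve of positive curvature, with the sign convention
  \<open>N' = - \<kappa> T + \<tau> B\<close>.\<close>

definition curvature :: "real \<Rightarrow> (real \<Rightarrow> real^3) \<Rightarrow> real \<Rightarrow> real" where
  "curvature l \<gamma> t = norm (vderiv l (vderiv l \<gamma>) t)"

definition frenet_T :: "real \<Rightarrow> (real \<Rightarrow> real^3) \<Rightarrow> real \<Rightarrow> real^3" where
  "frenet_T l \<gamma> t = vderiv l \<gamma> t"

definition frenet_N :: "real \<Rightarrow> (real \<Rightarrow> real^3) \<Rightarrow> real \<Rightarrow> real^3" where
  "frenet_N l \<gamma> t = vderiv l (frenet_T l \<gamma>) t /\<^sub>R curvature l \<gamma> t"

definition frenet_B :: "real \<Rightarrow> (real \<Rightarrow> real^3) \<Rightarrow> real \<Rightarrow> real^3" where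
  "frenet_B l \<gamma> t = cross3 (frenet_T l \<gamma> t) (frenet_N l \<gamma> t)"

definition torsion :: "real \<Rightarrow> (real \<Rightarrow> real^3) \<Rightarrow> real \<Rightarrow> real" where
  "torsion l \<gamma> t = vderiv l (frenet_N l \<gamma>) t \<bullet> frenet_B l \<gamma> t"

text \<open>Weak derivatives on an open set \<open>S\<close> of reals.\<close>

definition test_functions :: "real set \<Rightarrow> (real \<Rightarrow> real) set" where
  "test_functions S =
     {\<phi>. (\<forall>k. (deriv ^^ k) \<phi> differentiable_on UNIV) \<and>
          compact (closure {x. \<phi> x \<noteq> 0}) \<and> closure {x. \<phi> x \<noteq> 0} \<subseteq> S}"

definition locally_integrable :: "real set \<Rightarrow> (real \<Rightarrow> real) \<Rightarrow> bool" where
  "locally_integrable S f \<longleftrightarrow>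
     (\<forall>K. compact K \<and> K \<subseteq> S \<longrightarrow> f absolutely_integrable_on K)"

definition has_weak_deriv :: "real set \<Rightarrow> (real \<Rightarrow> real) \<Rightarrow> (real \<Rightarrow> real) \<Rightarrow> bool" where
  "has_weak_deriv S f g \<longleftrightarrow>
     locally_integrable S f \<and> locally_integrable S g \<and>
     (\<forall>\<phi>\<in>test_functions S.
        (LINT x|lebesgue_on S. f x * deriv \<phi> x) = - (LINT x|lebesgue_on S. g x * \<phi> x))"

text \<open>A weak derivative is unique only up to null sets, so \<open>weak_deriv\<close> is an arbitrary
  representative and should be used only under an integral.\<close>

definition weak_deriv :: "real set \<Rightarrow> (real \<Rightarrow> real) \<Rightarrow> real \<Rightarrow> real" where
  "weak_deriv S f = (SOME g. has_weak_deriv S f g)"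

definition L4 :: "real set \<Rightarrow> (real \<Rightarrow> real) set" where
  "L4 S = {f \<in> borel_measurable (lebesgue_on S). integrable (lebesgue_on S) (\<lambda>x. \<bar>f x\<bar> ^ 4)}"

text \<open>Elements of \<open>W\<^sup>1\<^sup>,\<^sup>4([0,l])\<close> are represented by functions continuous on \<open>{0..l}\<close>; two functions
  that agree on \<open>{0..l}\<close> represent the same element.\<close>

definition W14 :: "real \<Rightarrow> (real \<Rightarrow> real) set" where
  "W14 l = {\<theta>. continuous_on {0..l} \<theta> \<and> \<theta> \<in> L4 {0<..<l} \<and>
                (\<exists>g\<in>L4 {0<..<l}. has_weak_deriv {0<..<l} \<theta> g)}"

text \<open>Division is that of \<^typ>\<open>ennreal\<close>, where \<open>0 / 0 = 0\<close> and \<open>a / 0 = \<infinity>\<close> for \<open>a \<noteq> 0\<close>: this is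
  the convention for points where the denominator vanishes.\<close>

definition energy :: "real \<Rightarrow> (real \<Rightarrow> real) \<Rightarrow> (real \<Rightarrow> real) \<Rightarrow> (real \<Rightarrow> real) \<Rightarrow> ennreal" where
  "energy l \<kappa> \<tau> \<theta> =
     (\<integral>\<^sup>+ t\<in>{0..l}.
        ennreal (((\<kappa> t)\<^sup>2 * (cos (\<theta> t))\<^sup>2 + (weak_deriv {0<..<l} \<theta> t + \<tau> t)\<^sup>2)\<^sup>2)
          / ennreal ((\<kappa> t)\<^sup>2 * (cos (\<theta> t))\<^sup>2) \<partial>lebesgue)"

definition is_minimizer :: "real \<Rightarrow> ((real \<Rightarrow> real) \<Rightarrow> ennreal) \<Rightarrow> (real \<Rightarrow> real) \<Rightarrow> bool" where
  "is_minimizer l E \<theta> \<longleftrightarrow> \<theta> \<in> W14 l \<and> (\<forall>\<phi>\<in>W14 l. E \<theta> \<le> E \<phi>)"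

definition singular_points :: "real \<Rightarrow> (real \<Rightarrow> real) \<Rightarrow> real set" where
  "singular_points l \<theta> = {t\<in>{0..l}. \<exists>k::int. \<theta> t = pi / 2 + pi * of_int k}"

end

theory Submission
  imports Defs "HOL-Computational_Algebra.Polynomial"
begin

text \<open>The mean of \<open>p = \<theta>' + \<tau>\<close> cannot be large for a minimizer. Write \<open>c = \<kappa> \<bar>cos \<theta>\<bar>\<close>. The integrand
  of the energy is \<open>(c\<^sup>2 + p\<^sup>2)\<^sup>2 / c\<^sup>2\<close>, which by the arithmetic-geometric mean inequality is at least
  \<open>4 p\<^sup>2\<close>. With the Cauchy-Schwarz inequality, the energy of \<open>\<theta>\<close> is at least \<open>4 D\<^sup>2 / l\<close>, where
  \<open>D = \<theta>(l) - \<theta>(0) + \<tau> l\<close> is the integral of \<open>p\<close> (\<open>energy_lower_bound\<close>). On the other hand, the function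
  \<open>t \<mapsto> - \<tau> t\<close> has \<open>p = 0\<close>, so its energy is the integral of \<open>c\<^sup>2\<close>, at most \<open>K\<^sup>2 l\<close> with
  \<open>K = max \<kappa>\<close> (\<open>energy_linear_le\<close>). A minimizer therefore satisfies \<open>\<bar>D\<bar> \<le> K l / 2\<close>, and the assumption
  \<open>\<bar>\<tau>\<bar> l > n \<pi> + K l\<close> forces \<open>\<bar>\<theta>(l) - \<theta>(0)\<bar> > n \<pi>\<close>. By continuity \<open>\<theta>\<close> then passes through at least
  \<open>n\<close> points of \<open>\<pi>/2 + \<pi> \<int>\<close> (\<open>many_singular_points\<close>).

  The weak derivative enters only through test functions. Smooth cutoffs of an interval, built from
  \<open>exp (- 1 / x)\<close>, serve twice: letting them tend to \<open>1\<close> turns the definition of the weak derivative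
  into a statement about \<open>\<theta>(l) - \<theta>(0)\<close> (\<open>cutoff_deriv_tendsto\<close>), and testing with them on small
  intervals proves that weak derivatives are unique almost everywhere (\<open>weak_deriv_unique\<close>), which
  is needed to evaluate the energy of the linear competitor.\<close>

section \<open>Functions vanishing to infinite order at a point\<close>

text \<open>For \<open>p = 1\<close> this is the standard smooth function that is flat at \<open>0\<close>. The polynomial
  factor in \<open>1 / x\<close> makes the family closed under differentiation, so that smoothness of all its
  members follows from a single computation of a first derivative.\<close>
definition flat :: "real poly \<Rightarrow> real \<Rightarrow> real" where
  "flat p x = (if x > 0 then poly p (1 / x) * exp (- (1 / x)) else 0)"

lemma poly_exp_minus_tendsto_0:
  fixes p :: "real poly"
  shows "((\<lambda>y. poly p y * exp (- y)) \<longlongrightarrow> 0) at_top"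
proof -
  have "((\<lambda>y. \<Sum>i\<le>degree p. coeff p i * (y ^ i / exp y)) \<longlongrightarrow> (\<Sum>i\<le>degree p. coeff p i * 0)) at_top"
    by (intro tendsto_intros tendsto_power_div_exp_0)
  then show ?thesis
    by (simp add: poly_altdef sum_distrib_right exp_minus divide_inverse mult.assoc)
qed

lemma flat_tendsto_0_at_right: "(flat p \<longlongrightarrow> 0) (at_right 0)"
proof -
  have "((\<lambda>x. poly p (inverse x) * exp (- inverse x)) \<longlongrightarrow> 0) (at_right 0)"
    by (rule filterlim_compose[OF poly_exp_minus_tendsto_0 filterlim_inverse_at_top_right])
  moreover have "\<forall>\<^sub>F x in at_right 0. poly p (inverse x) * exp (- inverse x) = flat p x"
    by (rule eventually_mono[OF eventually_at_right_less]) (simp add: flat_def inverse_eq_divide)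
  ultimately show ?thesis
    by (rule Lim_transform_eventually)
qed

text \<open>With \<open>y = 1 / x\<close> one has \<open>dy/dx = - y\<^sup>2\<close>, hence
  \<open>d/dx (p(y) exp(-y)) = y\<^sup>2 (p(y) - p'(y)) exp(-y)\<close>.\<close>
definition flat_pderiv :: "real poly \<Rightarrow> real poly" where
  "flat_pderiv p = [:0, 0, 1:] * (p - pderiv p)"

text \<open>Away from \<open>0\<close> this is the chain rule. At \<open>0\<close> the difference quotient is again a member
  of the family, namely the one for the polynomial \<open>y p(y)\<close>, and therefore tends to \<open>0\<close>.\<close>
lemma flat_has_derivative: "(flat p has_real_derivative flat (flat_pderiv p) x) (at x)"
proof -
  consider "x > 0" | "x < 0" | "x = 0" by linarith
  then show ?thesis
  proof cases
    case 1
    have inv: "((\<lambda>x. 1 / x) has_real_derivative - (1 / x\<^sup>2)) (at x)"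
      using 1 by (auto intro!: derivative_eq_intros simp: power2_eq_square)
    have "((\<lambda>x. poly p (1 / x) * exp (- (1 / x))) has_real_derivative
        poly (pderiv p) (1 / x) * (- (1 / x\<^sup>2)) * exp (- (1 / x)) +
        exp (- (1 / x)) * - (- (1 / x\<^sup>2)) * poly p (1 / x)) (at x)"
      by (intro DERIV_mult DERIV_chain2[OF poly_DERIV inv] DERIV_chain2[OF DERIV_exp] DERIV_minus inv)
    also have "poly (pderiv p) (1 / x) * (- (1 / x\<^sup>2)) * exp (- (1 / x)) +
        exp (- (1 / x)) * - (- (1 / x\<^sup>2)) * poly p (1 / x) = flat (flat_pderiv p) x"
      using 1 by (simp add: flat_def flat_pderiv_def power2_eq_square ring_distribs)
    finally have "((\<lambda>x. poly p (1 / x) * exp (- (1 / x))) has_real_derivative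
        flat (flat_pderiv p) x) (at x)" .
    then show ?thesis
      by (rule has_field_derivative_transform_within_open[where S = "{0<..}"])
        (use 1 in \<open>auto simp: flat_def\<close>)
  next
    case 2
    have "((\<lambda>x. 0) has_real_derivative flat (flat_pderiv p) x) (at x)"
      using 2 by (simp add: flat_def)
    then show ?thesis
      by (rule has_field_derivative_transform_within_open[where S = "{..<0}"])
        (use 2 in \<open>auto simp: flat_def\<close>)
  next
    case 3
    have "((\<lambda>h. flat p h / h) \<longlongrightarrow> 0) (at_right 0)"
    proof (rule Lim_transform_eventually[OF flat_tendsto_0_at_right])
      show "\<forall>\<^sub>F h in at_right 0. flat ([:0, 1:] * p) h = flat p h / h"
        by (rule eventually_mono[OF eventually_at_right_less]) (simp add: flat_def)
    qed
    moreover have "((\<lambda>h. flat p h / h) \<longlongrightarrow> 0) (at_left 0)"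
    proof (rule Lim_transform_eventually[OF tendsto_const])
      show "\<forall>\<^sub>F h in at_left 0. 0 = flat p h / h"
        by (auto simp: flat_def eventually_at_left_field intro!: exI[of _ "-1"])
    qed
    ultimately have "((\<lambda>h. flat p h / h) \<longlongrightarrow> 0) (at 0)"
      by (simp add: filterlim_at_split)
    then show ?thesis
      using 3 by (simp add: DERIV_def flat_def)
  qed
qed

text \<open>A class of functions that contains the cutoffs below and is mapped into itself by
  differentiation; the Leibniz rule is what forces closure under sums. Membership yields all
  higher derivatives at once, with no formula for any of them.\<close>
inductive_set flat_algebra :: "(real \<Rightarrow> real) set" where
  flat: "(\<lambda>x. flat p (a * x + b)) \<in> flat_algebra"
| cmult: "f \<in> flat_algebra \<Longrightarrow> (\<lambda>x. c * f x) \<in> flat_algebra"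
| add: "f \<in> flat_algebra \<Longrightarrow> g \<in> flat_algebra \<Longrightarrow> (\<lambda>x. f x + g x) \<in> flat_algebra"
| mult: "f \<in> flat_algebra \<Longrightarrow> g \<in> flat_algebra \<Longrightarrow> (\<lambda>x. f x * g x) \<in> flat_algebra"

lemma flat_algebra_deriv:
  assumes "f \<in> flat_algebra"
  shows "\<exists>f'\<in>flat_algebra. \<forall>x. (f has_real_derivative f' x) (at x)"
  using assms
proof induction
  case (flat p a b)
  have "((\<lambda>x. flat p (a * x + b)) has_real_derivative a * flat (flat_pderiv p) (a * x + b)) (at x)" for x
  proof -
    have "((\<lambda>x. a * x + b) has_real_derivative a) (at x)"
      by (auto intro!: derivative_eq_intros)
    from DERIV_chain2[OF flat_has_derivative this] show ?thesis
      by (simp add: mult.commute)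
  qed
  then show ?case
    by (intro bexI[of _ "\<lambda>x. a * flat (flat_pderiv p) (a * x + b)"] allI)
      (auto intro: flat_algebra.intros)
next
  case (cmult f c)
  then obtain f' where "f' \<in> flat_algebra" "\<And>x. (f has_real_derivative f' x) (at x)" by blast
  then show ?case
    by (intro bexI[of _ "\<lambda>x. c * f' x"]) (auto intro!: flat_algebra.cmult derivative_eq_intros)
next
  case (add f g)
  then obtain f' g' where "f' \<in> flat_algebra" "\<And>x. (f has_real_derivative f' x) (at x)"
    "g' \<in> flat_algebra" "\<And>x. (g has_real_derivative g' x) (at x)" by blast
  then show ?case
    by (intro bexI[of _ "\<lambda>x. f' x + g' x"]) (auto intro!: flat_algebra.add derivative_eq_intros)
next
  case (mult f g)
  then obtain f' g' where fg: "f' \<in> flat_algebra" "\<And>x. (f has_real_derivative f' x) (at x)"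
    "g' \<in> flat_algebra" "\<And>x. (g has_real_derivative g' x) (at x)" by blast
  have "(\<lambda>x. f' x * g x + g' x * f x) \<in> flat_algebra"
    using mult.hyps fg by (intro flat_algebra.add flat_algebra.mult)
  then show ?case
    using fg by (intro bexI[of _ "\<lambda>x. f' x * g x + g' x * f x"]) (auto intro!: DERIV_mult)
qed

lemma flat_algebra_smooth:
  assumes "f \<in> flat_algebra"
  shows "(deriv ^^ k) f differentiable_on UNIV"
proof -
  have step: "deriv f \<in> flat_algebra" if f: "f \<in> flat_algebra" for f
  proof -
    obtain f' where "f' \<in> flat_algebra" "\<And>x. (f has_real_derivative f' x) (at x)"
      using flat_algebra_deriv[OF f] by blast
    moreover from this have "deriv f = f'" by (auto intro: DERIV_imp_deriv)
    ultimately show ?thesis by simp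
  qed
  have "(deriv ^^ k) f \<in> flat_algebra"
    by (induction k) (use assms step in auto)
  then show ?thesis
    using flat_algebra_deriv
    by (fastforce simp: differentiable_on_def real_differentiable_def)
qed

section \<open>Smooth cutoffs of an interval\<close>

text \<open>The shift by \<open>1\<close> keeps the support inside \<open>{a + 1/M..b - 1/M}\<close> with \<open>M = Suc m\<close>, hence
  compactly inside the open interval; the growing slope \<open>M\<close> pushes the values towards \<open>1\<close>.\<close>
definition cutoff :: "real \<Rightarrow> real \<Rightarrow> nat \<Rightarrow> real \<Rightarrow> real" where
  "cutoff a b m x = flat 1 (real (Suc m) * (x - a) - 1) * flat 1 (real (Suc m) * (b - x) - 1)"

lemma flat_1_bounds: "0 \<le> flat 1 x" "flat 1 x \<le> 1"
  by (auto simp: flat_def)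

lemma cutoff_bounds: "0 \<le> cutoff a b m x" "cutoff a b m x \<le> 1"
  unfolding cutoff_def using flat_1_bounds by (auto intro: mult_le_one)

lemma cutoff_in_flat_algebra: "cutoff a b m \<in> flat_algebra"
proof -
  define M where "M = real (Suc m)"
  have "(\<lambda>x. flat 1 (M * x + (- M * a - 1)) * flat 1 ((- M) * x + (M * b - 1))) \<in> flat_algebra"
    by (intro flat_algebra.intros)
  also have "(\<lambda>x. flat 1 (M * x + (- M * a - 1)) * flat 1 ((- M) * x + (M * b - 1))) = cutoff a b m"
    by (rule ext) (simp add: cutoff_def M_def[symmetric] algebra_simps del: of_nat_Suc)
  finally show ?thesis .
qed

lemma cutoff_test_function: "cutoff a b m \<in> test_functions {a<..<b}"
proof -
  define M where "M = real (Suc m)"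
  have M: "M > 0" by (simp add: M_def)
  have "{x. cutoff a b m x \<noteq> 0} \<subseteq> {a + 1 / M..b - 1 / M}"
    using M by (auto simp: cutoff_def M_def[symmetric] flat_def field_simps simp del: of_nat_Suc split: if_splits)
  then have cl: "closure {x. cutoff a b m x \<noteq> 0} \<subseteq> {a + 1 / M..b - 1 / M}"
    by (rule closure_minimal) simp
  then have "compact (closure {x. cutoff a b m x \<noteq> 0})"
    by (meson bounded_closed_interval bounded_subset closed_closure compact_eq_bounded_closed)
  moreover have "{a + 1 / M..b - 1 / M} \<subseteq> {a<..<b}"
  proof -
    have e: "0 < 1 / M" using M by simp
    show ?thesis
    proof
      fix x assume "x \<in> {a + 1 / M..b - 1 / M}"
      then have "a + 1 / M \<le> x" "x \<le> b - 1 / M" by simp_all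
      with e have "a < x" "x < b" by linarith+
      then show "x \<in> {a<..<b}" by simp
    qed
  qed
  ultimately show ?thesis
    using cl flat_algebra_smooth[OF cutoff_in_flat_algebra]
    by (auto simp: test_functions_def)
qed

lemma cutoff_tendsto:
  assumes "x \<in> {a<..<b}"
  shows "(\<lambda>m. cutoff a b m x) \<longlonglongrightarrow> 1"
proof -
  have flat: "(flat 1 \<longlongrightarrow> 1) at_top"
  proof -
    have "((\<lambda>x::real. exp (- inverse x)) \<longlongrightarrow> exp (- 0)) at_top"
      by (intro tendsto_intros tendsto_inverse_0_at_top filterlim_ident)
    moreover have "\<forall>\<^sub>F x in at_top. exp (- inverse x) = flat 1 x"
      using eventually_gt_at_top[of 0] by eventually_elim (simp add: flat_def inverse_eq_divide)
    ultimately have "(flat 1 \<longlongrightarrow> exp (- 0)) at_top"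
      by (rule Lim_transform_eventually)
    then show ?thesis by simp
  qed
  have lim: "filterlim (\<lambda>m. real (Suc m) * d - 1) at_top sequentially" if "d > 0" for d
  proof -
    have "filterlim (\<lambda>m. real (Suc m)) at_top sequentially"
      by (rule filterlim_compose[OF filterlim_real_sequentially filterlim_Suc])
    from filterlim_tendsto_pos_mult_at_top[OF tendsto_const that this]
    have "filterlim (\<lambda>m. - 1 + d * real (Suc m)) at_top sequentially"
      by (rule filterlim_tendsto_add_at_top[OF tendsto_const])
    then show ?thesis by (simp add: algebra_simps)
  qed
  have "(\<lambda>m. cutoff a b m x) \<longlonglongrightarrow> 1 * 1"
    unfolding cutoff_def using assms
    by (intro tendsto_mult filterlim_compose[OF flat] lim) auto
  then show ?thesis by simp
qed

section \<open>Testing against the cutoffs\<close>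

lemma test_functionD:
  assumes "\<phi> \<in> test_functions S"
  shows "(\<phi> has_real_derivative deriv \<phi> x) (at x)"
    and "continuous_on A \<phi>" and "continuous_on A (deriv \<phi>)" and "x \<notin> S \<Longrightarrow> \<phi> x = 0"
proof -
  have smooth: "(deriv ^^ k) \<phi> differentiable_on UNIV" for k
    using assms by (simp add: test_functions_def)
  show "(\<phi> has_real_derivative deriv \<phi> x) (at x)"
    using smooth[of 0] by (simp add: DERIV_deriv_iff_real_differentiable differentiable_on_def)
  show "continuous_on A \<phi>"
    using differentiable_imp_continuous_on[OF smooth[of 0]] by (auto intro: continuous_on_subset)
  show "continuous_on A (deriv \<phi>)"
    using differentiable_imp_continuous_on[OF smooth[of 1]] by (auto intro: continuous_on_subset)
  show "\<phi> x = 0" if "x \<notin> S"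
    using assms that closure_subset[of "{x. \<phi> x \<noteq> 0}"] unfolding test_functions_def by blast
qed

lemma test_functions_mono: "S \<subseteq> T \<Longrightarrow> test_functions S \<subseteq> test_functions T"
  by (auto simp: test_functions_def)

lemma integrable_mult_test_function:
  assumes g: "locally_integrable S g" and \<phi>: "\<phi> \<in> test_functions S" and S: "S \<in> sets lebesgue"
  shows "integrable (lebesgue_on S) (\<lambda>x. g x * \<phi> x)"
proof -
  define K where "K = closure {x. \<phi> x \<noteq> 0}"
  have K: "compact K" "K \<subseteq> S"
    using \<phi> by (auto simp: test_functions_def K_def)
  have out: "\<phi> x = 0" if "x \<notin> K" for x
    using that closure_subset[of "{x. \<phi> x \<noteq> 0}"] unfolding K_def by blast
  have "bounded (\<phi> ` K)"
    using K test_functionD(2)[OF \<phi>] by (intro compact_imp_bounded compact_continuous_image)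
  moreover have Kl: "K \<in> sets lebesgue"
    using K by (simp add: borel_compact)
  moreover have "\<phi> \<in> borel_measurable (lebesgue_on K)"
    using test_functionD(2)[OF \<phi>] Kl by (rule continuous_imp_measurable_on_sets_lebesgue)
  moreover have "g absolutely_integrable_on K"
    using g K by (simp add: locally_integrable_def)
  ultimately have "(\<lambda>x. \<phi> x * g x) absolutely_integrable_on K"
    by (intro absolutely_integrable_bounded_measurable_product_real) auto
  then have "integrable lebesgue (\<lambda>x. indicator K x *\<^sub>R (\<phi> x * g x))"
    by (simp add: set_integrable_def)
  also have "(\<lambda>x. indicator K x *\<^sub>R (\<phi> x * g x)) = (\<lambda>x. indicator S x *\<^sub>R (g x * \<phi> x))"
  proof
    show "indicator K x *\<^sub>R (\<phi> x * g x) = indicator S x *\<^sub>R (g x * \<phi> x)" for x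
      using K out[of x] by (cases "x \<in> K") auto
  qed
  finally show ?thesis
    using S by (simp add: integrable_restrict_space)
qed

lemma lebesgue_on_open_interval:
  fixes f :: "real \<Rightarrow> real"
  assumes "continuous_on {a..b} f"
  shows "integrable (lebesgue_on {a<..<b}) f"
    and "(LINT x|lebesgue_on {a<..<b}. f x) = integral {a..b} f"
proof -
  have "f absolutely_integrable_on {a<..<b}"
    using absolutely_integrable_continuous_real[OF assms]
    by (rule set_integrable_subset) auto
  then show i: "integrable (lebesgue_on {a<..<b}) f"
    by (simp add: integrable_restrict_space set_integrable_def)
  show "(LINT x|lebesgue_on {a<..<b}. f x) = integral {a..b} f"
    using lebesgue_integral_eq_integral[OF i] by (simp add: integral_open_interval_real)
qed

lemma has_integral_real_derivative:
  fixes F :: "real \<Rightarrow> real"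
  assumes "a \<le> b" and F: "\<And>x. (F has_real_derivative f x) (at x)"
  shows "(f has_integral F b - F a) {a..b}"
  using \<open>a \<le> b\<close>
proof (rule fundamental_theorem_of_calculus)
  show "(F has_vector_derivative f x) (at x within {a..b})" for x
    using has_field_derivative_at_within[OF F]
    by (simp add: has_real_derivative_iff_has_vector_derivative)
qed

text \<open>No boundary terms occur because a test function vanishes at both endpoints.\<close>
lemma test_function_by_parts:
  fixes p :: "real \<Rightarrow> real"
  assumes \<phi>: "\<phi> \<in> test_functions {a<..<b}" and "a \<le> b"
    and p: "\<And>x. (p has_real_derivative p' x) (at x)" and p': "continuous_on {a..b} p'"
  shows "(LINT x|lebesgue_on {a<..<b}. p x * deriv \<phi> x) = - (LINT x|lebesgue_on {a<..<b}. p' x * \<phi> x)"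
proof -
  note \<phi>' = test_functionD[OF \<phi>]
  have cp: "continuous_on {a..b} p"
    using p DERIV_isCont by (blast intro: continuous_at_imp_continuous_on)
  have "((\<lambda>x. p x * \<phi> x) has_real_derivative p x * deriv \<phi> x + p' x * \<phi> x) (at x)" for x
    using DERIV_mult[OF p \<phi>'(1)] by (simp add: algebra_simps)
  from has_integral_real_derivative[OF \<open>a \<le> b\<close> this]
  have "integral {a..b} (\<lambda>x. p x * deriv \<phi> x + p' x * \<phi> x) = 0"
    using \<phi>'(4)[of a] \<phi>'(4)[of b] by (simp add: integral_unique)
  moreover have "integral {a..b} (\<lambda>x. p x * deriv \<phi> x + p' x * \<phi> x) =
      integral {a..b} (\<lambda>x. p x * deriv \<phi> x) + integral {a..b} (\<lambda>x. p' x * \<phi> x)"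
    by (intro Henstock_Kurzweil_Integration.integral_add integrable_continuous_real continuous_intros cp p' \<phi>')
  moreover have "continuous_on {a..b} (\<lambda>x. p x * deriv \<phi> x)" "continuous_on {a..b} (\<lambda>x. p' x * \<phi> x)"
    by (intro continuous_intros cp p' \<phi>')+
  ultimately show ?thesis
    by (simp add: lebesgue_on_open_interval)
qed

lemma LINT_mult_cutoff_tendsto:
  assumes f: "integrable (lebesgue_on {a<..<b}) f"
  shows "(\<lambda>m. LINT x|lebesgue_on {a<..<b}. f x * cutoff a b m x) \<longlonglongrightarrow> (LINT x|lebesgue_on {a<..<b}. f x)"
proof (rule integral_dominated_convergence[where w = "\<lambda>x. \<bar>f x\<bar>"])
  show "(\<lambda>x. f x * cutoff a b m x) \<in> borel_measurable (lebesgue_on {a<..<b})" for m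
    by (intro borel_measurable_times borel_measurable_integrable[OF f]
        continuous_imp_measurable_on_sets_lebesgue test_functionD(2)[OF cutoff_test_function]) simp
  show "AE x in lebesgue_on {a<..<b}. norm (f x * cutoff a b m x) \<le> \<bar>f x\<bar>" for m
    using cutoff_bounds by (auto simp: abs_mult intro!: mult_left_le)
  show "AE x in lebesgue_on {a<..<b}. (\<lambda>m. f x * cutoff a b m x) \<longlonglongrightarrow> f x"
  proof (rule AE_I2)
    fix x assume "x \<in> space (lebesgue_on {a<..<b})"
    then have "(\<lambda>m. f x * cutoff a b m x) \<longlonglongrightarrow> f x * 1"
      by (intro tendsto_mult tendsto_const cutoff_tendsto) (simp add: space_restrict_space)
    then show "(\<lambda>m. f x * cutoff a b m x) \<longlonglongrightarrow> f x" by simp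
  qed
qed (use f in auto)

lemma flat_1_deriv_nonneg: "0 \<le> flat (flat_pderiv 1) x"
  by (simp add: flat_def flat_pderiv_def)

text \<open>A cutoff is a product \<open>u v\<close> with \<open>u\<close> increasing, \<open>v\<close> decreasing and values in \<open>[0,1]\<close>,
  so \<open>\<bar>(u v)'\<bar> \<le> u' - v'\<close>, and the integral of the right-hand side telescopes. The bound is uniform
  in \<open>m\<close>, which is what makes the approximation argument in the next lemma work.\<close>
lemma cutoff_variation:
  assumes "a \<le> b"
  shows "integral {a..b} (\<lambda>x. \<bar>deriv (cutoff a b m) x\<bar>) \<le> 2"
proof -
  define M where "M = real (Suc m)"
  have M: "M > 0" by (simp add: M_def)
  let ?u = "\<lambda>x. flat 1 (M * (x - a) - 1)" and ?v = "\<lambda>x. flat 1 (M * (b - x) - 1)"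
  let ?u' = "\<lambda>x. M * flat (flat_pderiv 1) (M * (x - a) - 1)"
    and ?v' = "\<lambda>x. M * flat (flat_pderiv 1) (M * (b - x) - 1)"
  have "((\<lambda>x. M * (x - a) - 1) has_real_derivative M) (at x)" for x
    by (auto intro!: derivative_eq_intros)
  from DERIV_chain2[OF flat_has_derivative this]
  have u: "(?u has_real_derivative ?u' x) (at x)" for x by (simp add: mult.commute)
  have "((\<lambda>x. M * (b - x) - 1) has_real_derivative - M) (at x)" for x
    by (auto intro!: derivative_eq_intros)
  from DERIV_chain2[OF flat_has_derivative this]
  have v: "(?v has_real_derivative - ?v' x) (at x)" for x by (simp add: mult.commute)
  have "((\<lambda>x. ?u x * ?v x) has_real_derivative ?u' x * ?v x + (- ?v' x) * ?u x) (at x)" for x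
    by (rule DERIV_mult[OF u v])
  from DERIV_imp_deriv[OF this]
  have deriv: "deriv (cutoff a b m) x = ?u' x * ?v x - ?v' x * ?u x" for x
    unfolding cutoff_def[abs_def] M_def[symmetric] by simp
  have nonneg: "0 \<le> ?u' x" "0 \<le> ?v' x" for x
    using M flat_1_deriv_nonneg by simp_all
  have bound: "\<bar>deriv (cutoff a b m) x\<bar> \<le> ?u' x + ?v' x" for x
  proof -
    have "0 \<le> ?u' x * ?v x" "?u' x * ?v x \<le> ?u' x" "0 \<le> ?v' x * ?u x" "?v' x * ?u x \<le> ?v' x"
      using nonneg[of x] flat_1_bounds by (simp_all add: mult_left_le)
    then show ?thesis unfolding deriv by linarith
  qed
  have int: "((\<lambda>x. ?u' x + ?v' x) has_integral (?u b - ?v b) - (?u a - ?v a)) {a..b}"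
    by (rule has_integral_real_derivative[OF \<open>a \<le> b\<close>]) (use DERIV_diff[OF u v] in simp)
  have "integral {a..b} (\<lambda>x. \<bar>deriv (cutoff a b m) x\<bar>) \<le> (?u b - ?v b) - (?u a - ?v a)"
  proof (rule has_integral_le[OF _ int])
    show "((\<lambda>x. \<bar>deriv (cutoff a b m) x\<bar>) has_integral integral {a..b} (\<lambda>x. \<bar>deriv (cutoff a b m) x\<bar>)) {a..b}"
      using test_functionD(3)[OF cutoff_test_function]
      by (intro integrable_integral integrable_continuous_real continuous_intros)
  qed (rule bound)
  also have "\<dots> \<le> 2"
    using flat_1_bounds[of "M * (b - a) - 1"] by (simp add: flat_def)
  finally show ?thesis .
qed

text \<open>In the limit the derivative of the cutoff is a unit mass at \<open>a\<close> minus a unit mass at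
  \<open>b\<close>. For a polynomial in place of \<open>\<theta>\<close> this follows from integration by parts and dominated
  convergence; the uniform variation bound carries it over to the uniform closure of the
  polynomials. Together with the defining identity of the weak derivative, this recovers the total
  increment of a Sobolev function without identifying it as an indefinite integral.\<close>
lemma cutoff_deriv_tendsto:
  fixes \<theta> :: "real \<Rightarrow> real"
  assumes "a \<le> b" and \<theta>: "continuous_on {a..b} \<theta>"
  shows "(\<lambda>m. LINT x|lebesgue_on {a<..<b}. \<theta> x * deriv (cutoff a b m) x) \<longlonglongrightarrow> \<theta> a - \<theta> b"
proof (rule LIMSEQ_I)
  fix e :: real assume "e > 0"
  \<comment> \<open>Five shares: two from the variation bound, one from the limit for \<open>p\<close>, two from the
    endpoint values.\<close>
  then have "e / 5 > 0" by simp
  obtain p where p: "real_polynomial_function p" "\<And>x. x \<in> {a..b} \<Longrightarrow> \<bar>\<theta> x - p x\<bar> < e / 5"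
    using Stone_Weierstrass_real_polynomial_function[OF compact_Icc \<theta> \<open>e / 5 > 0\<close>] by blast
  obtain p' where p': "real_polynomial_function p'" "\<And>x. (p has_real_derivative p' x) (at x)"
    using has_real_derivative_polynomial_function[OF p(1)] by blast
  have cont: "continuous_on A p" "continuous_on A p'" for A
    using p(1) p'(1) unfolding real_polynomial_function_eq
    by (auto intro: continuous_on_polymonial_function)
  have cd: "continuous_on A (deriv (cutoff a b m))" for A m
    by (rule test_functionD(3)[OF cutoff_test_function])
  have p_int: "(LINT x|lebesgue_on {a<..<b}. p' x) = p b - p a"
  proof -
    have "(p' has_integral p b - p a) {a..b}"
      by (rule has_integral_real_derivative[OF \<open>a \<le> b\<close> p'(2)])
    then show ?thesis
      by (simp add: lebesgue_on_open_interval cont integral_unique)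
  qed
  have "(\<lambda>m. LINT x|lebesgue_on {a<..<b}. p' x * cutoff a b m x) \<longlonglongrightarrow> p b - p a"
    using LINT_mult_cutoff_tendsto[OF lebesgue_on_open_interval(1)[OF cont(2)], of a b] p_int by simp
  from LIMSEQ_D[OF this \<open>e / 5 > 0\<close>] obtain N where
    N: "\<And>m. m \<ge> N \<Longrightarrow> \<bar>(LINT x|lebesgue_on {a<..<b}. p' x * cutoff a b m x) - (p b - p a)\<bar> < e / 5"
    by auto
  show "\<exists>N. \<forall>m\<ge>N. norm ((LINT x|lebesgue_on {a<..<b}. \<theta> x * deriv (cutoff a b m) x) - (\<theta> a - \<theta> b)) < e"
  proof (intro exI allI impI)
    fix m assume "m \<ge> N"
    let ?d = "deriv (cutoff a b m)"
    have split: "(LINT x|lebesgue_on {a<..<b}. \<theta> x * ?d x) =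
        integral {a..b} (\<lambda>x. (\<theta> x - p x) * ?d x) + (LINT x|lebesgue_on {a<..<b}. p x * ?d x)"
    proof -
      have "integral {a..b} (\<lambda>x. \<theta> x * ?d x) =
          integral {a..b} (\<lambda>x. (\<theta> x - p x) * ?d x + p x * ?d x)"
        by (simp add: algebra_simps)
      also have "\<dots> = integral {a..b} (\<lambda>x. (\<theta> x - p x) * ?d x) + integral {a..b} (\<lambda>x. p x * ?d x)"
        by (intro Henstock_Kurzweil_Integration.integral_add integrable_continuous_real continuous_intros \<theta> cont cd)
      finally show ?thesis
        using \<theta> cont cd by (simp add: lebesgue_on_open_interval continuous_on_mult)
    qed
    have "norm (integral {a..b} (\<lambda>x. (\<theta> x - p x) * ?d x)) \<le> integral {a..b} (\<lambda>x. e / 5 * \<bar>?d x\<bar>)"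
    proof (rule integral_norm_bound_integral)
      show "norm ((\<theta> x - p x) * ?d x) \<le> e / 5 * \<bar>?d x\<bar>" if "x \<in> {a..b}" for x
        unfolding real_norm_def abs_mult
        by (rule mult_right_mono[OF less_imp_le[OF p(2)[OF that]] abs_ge_zero])
    qed (intro integrable_continuous_real continuous_intros \<theta> cont cd)+
    also have "\<dots> \<le> e / 5 * 2"
      using cutoff_variation[OF \<open>a \<le> b\<close>, of m] \<open>e > 0\<close> by (simp add: mult_left_mono)
    finally have 1: "\<bar>integral {a..b} (\<lambda>x. (\<theta> x - p x) * ?d x)\<bar> \<le> e / 5 * 2" by simp
    have 2: "\<bar>(LINT x|lebesgue_on {a<..<b}. p x * ?d x) - (p a - p b)\<bar> < e / 5"
      using N[OF \<open>m \<ge> N\<close>]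
      unfolding test_function_by_parts[OF cutoff_test_function \<open>a \<le> b\<close> p'(2) cont(2)] by linarith
    have 3: "\<bar>\<theta> a - p a\<bar> < e / 5" "\<bar>\<theta> b - p b\<bar> < e / 5"
      using p(2) \<open>a \<le> b\<close> by auto
    show "norm ((LINT x|lebesgue_on {a<..<b}. \<theta> x * ?d x) - (\<theta> a - \<theta> b)) < e"
      unfolding split using 1 2 3 by (simp add: abs_if split: if_splits)
  qed
qed

section \<open>Uniqueness of weak derivatives\<close>

text \<open>The sets over which \<open>h\<close> has vanishing integral form a Dynkin system. It contains the
  intersection-stable family of open intervals, hence all Borel sets, and up to null sets all
  Lebesgue sets; a density whose set integrals all vanish is zero almost everywhere.\<close>
lemma AE_zero_of_zero_on_intervals:
  fixes h :: "real \<Rightarrow> real"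
  assumes h: "set_integrable lebesgue {a<..<b} h"
    and zero: "\<And>c d. a \<le> c \<Longrightarrow> d \<le> b \<Longrightarrow> set_lebesgue_integral lebesgue {c<..<d} h = 0"
  shows "AE x in lebesgue. x \<in> {a<..<b} \<longrightarrow> h x = 0"
proof -
  define H where "H x = indicator {a<..<b} x *\<^sub>R h x" for x
  have H: "integrable lebesgue H"
    using h by (simp add: set_integrable_def H_def[abs_def])
  have H_on: "set_integrable lebesgue A H" if "A \<in> sets lebesgue" for A
    using H that unfolding set_integrable_def by (rule integrable_mult_indicator[rotated])
  have H_interval: "set_lebesgue_integral lebesgue {c<..<d} H = 0" for c d
  proof -
    have "set_lebesgue_integral lebesgue {c<..<d} H = set_lebesgue_integral lebesgue {max a c<..<min b d} h"
      unfolding set_lebesgue_integral_def H_def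
      by (rule Bochner_Integration.integral_cong) (auto simp: indicator_def)
    then show ?thesis using zero by simp
  qed
  have H_UNIV: "set_lebesgue_integral lebesgue UNIV H = 0"
  proof -
    have "set_lebesgue_integral lebesgue UNIV H = set_lebesgue_integral lebesgue {a<..<b} H"
      unfolding set_lebesgue_integral_def H_def
      by (rule Bochner_Integration.integral_cong) (auto simp: indicator_def)
    then show ?thesis using H_interval by simp
  qed
  have G: "Int_stable (range (\<lambda>(c, d). box c (d::real)))"
    unfolding Int_stable_def by (auto simp: image_iff Int_greaterThanLessThan box_real)
  have borel_sets: "sigma_sets UNIV (range (\<lambda>(c, d). box c (d::real))) = sets borel"
    by (simp add: borel_eq_box)
  have H_borel: "set_lebesgue_integral lebesgue A H = 0" if "A \<in> sets borel" for A
  proof -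
    have "range (\<lambda>(c, d). box c (d::real)) \<subseteq> Pow UNIV" by simp
    moreover have "A \<in> sigma_sets UNIV (range (\<lambda>(c, d). box c (d::real)))"
      using that by (simp only: borel_sets)
    ultimately show ?thesis
    proof (induction rule: sigma_sets_induct_disjoint[OF G, consumes 2, case_names basic empty compl union])
      case (compl A)
      then have A: "A \<in> sets borel" by (simp only: borel_sets)
      have "set_lebesgue_integral lebesgue (A \<union> (UNIV - A)) H =
          set_lebesgue_integral lebesgue A H + set_lebesgue_integral lebesgue (UNIV - A) H"
        using A by (intro set_integral_Un H_on) auto
      then show ?case using compl H_UNIV by (simp add: Un_absorb1)
    next
      case (union A)
      then have "\<And>i. A i \<in> sets borel" unfolding borel_sets by blast
      then have "(LINT x:(\<Union>i. A i)|lebesgue. H x) = (\<Sum>i. LINT x:(A i)|lebesgue. H x)"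
        using union.hyps by (intro lebesgue_integral_countable_add H_on)
          (auto simp: disjoint_family_on_def)
      then show ?case using union.IH by simp
    qed (auto simp: H_interval box_real, simp add: set_lebesgue_integral_def)
  qed
  have H_lebesgue: "set_lebesgue_integral lebesgue A H = 0" if "A \<in> sets lebesgue" for A
  proof -
    from that obtain S N N' where A: "A = S \<union> N" "N \<subseteq> N'" "N' \<in> null_sets lborel" "S \<in> sets borel"
      by (auto elim: sets_completionE)
    have "N' \<in> null_sets lebesgue" using A(3) by (rule null_sets_completionI)
    moreover have "A \<in> sets lebesgue" "S \<in> sets lebesgue" using that A(4) by auto
    moreover have "(A - S) \<union> (S - A) \<subseteq> N'" using A by auto
    ultimately have "set_lebesgue_integral lebesgue A H = set_lebesgue_integral lebesgue S H"
      by (intro set_integral_null_delta H) (auto intro: null_sets_subset)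
    then show ?thesis using H_borel[OF A(4)] by simp
  qed
  have "AE x in lebesgue. H x = 0"
    using density_unique_real[OF H, of "\<lambda>_. 0"] H_lebesgue
    by (simp add: set_lebesgue_integral_def)
  then show ?thesis
    by eventually_elim (auto simp: H_def)
qed

text \<open>Testing with the cutoffs of a subinterval and passing to the limit shows that the integral
  of \<open>h\<close> over each compactly contained subinterval is zero. Since \<open>h\<close> is integrable only locally, the
  conclusion is first drawn on an exhaustion of the interval.\<close>
lemma fundamental_lemma_calculus_of_variations:
  fixes h :: "real \<Rightarrow> real"
  assumes h: "locally_integrable {A<..<B} h"
    and zero: "\<And>\<phi>. \<phi> \<in> test_functions {A<..<B} \<Longrightarrow> (LINT x|lebesgue_on {A<..<B}. h x * \<phi> x) = 0"
  shows "AE x in lebesgue. x \<in> {A<..<B} \<longrightarrow> h x = 0"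
proof -
  have int: "set_integrable lebesgue {c<..<d} h" if "A < c" "d < B" for c d
  proof -
    have "h absolutely_integrable_on {c..d}"
    proof -
      have "compact {c..d} \<and> {c..d} \<subseteq> {A<..<B}" using that by auto
      then show ?thesis using h unfolding locally_integrable_def by blast
    qed
    then show ?thesis by (rule set_integrable_subset) auto
  qed
  have interval: "set_lebesgue_integral lebesgue {c<..<d} h = 0" if "A < c" "d < B" for c d
  proof -
    have "(LINT x|lebesgue_on {c<..<d}. h x * cutoff c d m x) = 0" for m
    proof -
      have \<phi>: "cutoff c d m \<in> test_functions {c<..<d}" by (rule cutoff_test_function)
      have "(LINT x|lebesgue_on {c<..<d}. h x * cutoff c d m x) =
          (LINT x|lebesgue_on {A<..<B}. h x * cutoff c d m x)"
      proof -
        have "indicator {c<..<d} x *\<^sub>R (h x * cutoff c d m x) =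
            indicator {A<..<B} x *\<^sub>R (h x * cutoff c d m x)" for x
          using that test_functionD(4)[OF \<phi>, of x] by (cases "x \<in> {c<..<d}") auto
        then have "(LINT x|lebesgue. indicator {c<..<d} x *\<^sub>R (h x * cutoff c d m x)) =
            (LINT x|lebesgue. indicator {A<..<B} x *\<^sub>R (h x * cutoff c d m x))"
          by presburger
        then show ?thesis by (simp add: integral_restrict_space)
      qed
      also have "\<dots> = 0"
        using that by (intro zero subsetD[OF test_functions_mono \<phi>]) auto
      finally show ?thesis .
    qed
    moreover have "integrable (lebesgue_on {c<..<d}) h"
      using int[OF that] by (simp add: integrable_restrict_space set_integrable_def)
    ultimately have "(LINT x|lebesgue_on {c<..<d}. h x) = 0"
      using LINT_mult_cutoff_tendsto[of c d h] by (simp add: LIMSEQ_const_iff)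
    then show ?thesis
      by (simp add: integral_restrict_space set_lebesgue_integral_def)
  qed
  let ?e = "\<lambda>i::nat. 1 / real (Suc i)"
  have "AE x in lebesgue. x \<in> {A + ?e i<..<B - ?e i} \<longrightarrow> h x = 0" for i
  proof (rule AE_zero_of_zero_on_intervals)
    have e: "0 < ?e i" by simp
    then show "set_integrable lebesgue {A + ?e i<..<B - ?e i} h"
      by (intro int) linarith+
    show "set_lebesgue_integral lebesgue {c<..<d} h = 0" if "A + ?e i \<le> c" "d \<le> B - ?e i" for c d
      using that e by (intro interval) linarith+
  qed
  then have "AE x in lebesgue. \<forall>i. x \<in> {A + ?e i<..<B - ?e i} \<longrightarrow> h x = 0"
    unfolding AE_all_countable by blast
  then show ?thesis
  proof eventually_elim
    case (elim x)
    show ?case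
    proof
      assume "x \<in> {A<..<B}"
      then obtain i where "?e i < min (x - A) (B - x)"
        using nat_approx_posE[of "min (x - A) (B - x)"] by auto
      then have "x \<in> {A + ?e i<..<B - ?e i}" by auto
      with elim show "h x = 0" by blast
    qed
  qed
qed

lemma has_weak_deriv_weak_deriv:
  assumes "has_weak_deriv S f g"
  shows "has_weak_deriv S f (weak_deriv S f)"
  unfolding weak_deriv_def by (rule someI[where P = "has_weak_deriv S f", OF assms])

lemma weak_deriv_unique:
  assumes g: "has_weak_deriv {A<..<B} f g" and g': "has_weak_deriv {A<..<B} f g'"
  shows "AE x in lebesgue. x \<in> {A<..<B} \<longrightarrow> g x = g' x"
proof -
  have loc: "locally_integrable {A<..<B} g" "locally_integrable {A<..<B} g'"
    using g g' by (auto simp: has_weak_deriv_def)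
  have "AE x in lebesgue. x \<in> {A<..<B} \<longrightarrow> g x - g' x = 0"
  proof (rule fundamental_lemma_calculus_of_variations)
    show "locally_integrable {A<..<B} (\<lambda>x. g x - g' x)"
      using loc by (auto simp: locally_integrable_def intro: set_integral_diff)
    fix \<phi> assume \<phi>: "\<phi> \<in> test_functions {A<..<B}"
    have "(LINT x|lebesgue_on {A<..<B}. (g x - g' x) * \<phi> x) =
        (LINT x|lebesgue_on {A<..<B}. g x * \<phi> x) - (LINT x|lebesgue_on {A<..<B}. g' x * \<phi> x)"
      using loc \<phi> by (simp add: left_diff_distrib integrable_mult_test_function)
    also have "\<dots> = 0"
      using g g' \<phi> by (simp add: has_weak_deriv_def)
    finally show "(LINT x|lebesgue_on {A<..<B}. (g x - g' x) * \<phi> x) = 0" .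
  qed
  then show ?thesis by simp
qed

section \<open>Bounds on the energy\<close>

lemma locally_integrable_continuous:
  assumes "continuous_on {a..b} f"
  shows "locally_integrable {a<..<b} f"
  unfolding locally_integrable_def
proof (intro allI impI)
  fix K assume "compact K \<and> K \<subseteq> {a<..<b}"
  then show "f absolutely_integrable_on K"
    by (intro set_integrable_subset[OF absolutely_integrable_continuous_real[OF assms]])
      (auto simp: borel_compact)
qed

lemma linear_in_W14:
  assumes "l > 0"
  shows "has_weak_deriv {0<..<l} (\<lambda>t. c * t) (\<lambda>_. c)" and "(\<lambda>t. c * t) \<in> W14 l"
proof -
  have L4: "f \<in> L4 {0<..<l}" if "continuous_on {0..l} f" for f
    using that lebesgue_on_open_interval(1)[of 0 l "\<lambda>x. \<bar>f x\<bar> ^ 4"]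
      lebesgue_on_open_interval(1)[OF that]
    by (auto simp: L4_def intro!: continuous_intros)
  have lin: "((\<lambda>t. c * t) has_real_derivative c) (at x)" for x
    by (auto intro!: derivative_eq_intros)
  show wd: "has_weak_deriv {0<..<l} (\<lambda>t. c * t) (\<lambda>_. c)"
    unfolding has_weak_deriv_def
  proof (intro conjI ballI)
    show "(LINT x|lebesgue_on {0<..<l}. c * x * deriv \<phi> x) = - (LINT x|lebesgue_on {0<..<l}. c * \<phi> x)"
      if "\<phi> \<in> test_functions {0<..<l}" for \<phi>
      using assms by (intro test_function_by_parts[OF that] lin) auto
  qed (intro locally_integrable_continuous continuous_intros)+
  show "(\<lambda>t. c * t) \<in> W14 l"
    unfolding W14_def using wd
    by (auto intro!: L4 bexI[of _ "\<lambda>_. c"] continuous_intros)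
qed

text \<open>The linear competitor has \<open>\<theta>' + \<tau> = 0\<close>, which reduces the integrand to
  \<open>\<kappa>\<^sup>2 cos\<^sup>2 \<theta> \<le> K\<^sup>2\<close>. As \<open>weak_deriv\<close> is some weak derivative chosen arbitrarily, the value \<open>- c\<close>
  is known for it only almost everywhere, by uniqueness.\<close>
lemma energy_linear_le:
  assumes "l > 0" and \<kappa>: "\<And>t. t \<in> {0..l} \<Longrightarrow> \<bar>\<kappa> t\<bar> \<le> K" and \<tau>: "\<And>t. t \<in> {0..l} \<Longrightarrow> \<tau> t = c"
  shows "energy l \<kappa> \<tau> (\<lambda>t. - c * t) \<le> ennreal (K\<^sup>2 * l)"
proof -
  define g where "g = weak_deriv {0<..<l} (\<lambda>t. - c * t)"
  have wd: "has_weak_deriv {0<..<l} (\<lambda>t. - c * t) (\<lambda>_. - c)"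
    by (rule linear_in_W14[OF \<open>l > 0\<close>])
  from weak_deriv_unique[OF has_weak_deriv_weak_deriv[OF this] this, folded g_def]
  have "AE t in lebesgue. t \<in> {0<..<l} \<longrightarrow> g t = - c" .
  moreover have "AE t in lebesgue. t \<noteq> 0" "AE t in lebesgue. t \<noteq> l"
    by (rule AE_completion[OF AE_lborel_singleton])+
  ultimately have "AE t in lebesgue. t \<in> {0..l} \<longrightarrow> g t + \<tau> t = 0"
    by eventually_elim (use \<tau> in auto)
  then have "energy l \<kappa> \<tau> (\<lambda>t. - c * t) \<le> (\<integral>\<^sup>+ t. ennreal (K\<^sup>2) * indicator {0..l} t \<partial>lebesgue)"
    unfolding energy_def g_def[symmetric]
  proof (intro nn_integral_mono_AE, eventually_elim)
    case (elim t)
    let ?q = "(\<kappa> t)\<^sup>2 * (cos (- c * t))\<^sup>2"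
    have "ennreal ((?q + (g t + \<tau> t)\<^sup>2)\<^sup>2) / ennreal ?q \<le> ennreal (K\<^sup>2)" if t: "t \<in> {0..l}"
    proof (cases "?q = 0")
      case False
      then have "?q > 0" by (metis mult_nonneg_nonneg not_less_iff_gr_or_eq order_le_less zero_le_power2)
      moreover have "?q \<le> K\<^sup>2 * 1"
        using \<kappa>[OF t] by (intro mult_mono) (auto simp: abs_le_square_iff[symmetric] abs_square_le_1)
      ultimately show ?thesis
        using elim t by (simp add: divide_ennreal power2_eq_square ennreal_leI)
    next
      case True
      then have "(?q + (g t + \<tau> t)\<^sup>2)\<^sup>2 = 0" using elim t by simp
      then show ?thesis by (simp only: ennreal_0 ennreal_zero_divide zero_le)
    qed
    then show ?case by (auto simp: indicator_def)
  qed
  also have "\<dots> = ennreal (K\<^sup>2 * l)"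
    using \<open>l > 0\<close> by (simp add: nn_integral_cmult_indicator ennreal_mult)
  finally show ?thesis .
qed

text \<open>The arithmetic-geometric mean inequality \<open>4 q p\<^sup>2 \<le> (q + p\<^sup>2)\<^sup>2\<close>. Where \<open>q = 0\<close> the convention
  for a vanishing denominator gives \<open>0\<close> if \<open>p = 0\<close> and \<open>\<infinity>\<close> otherwise.\<close>
lemma energy_integrand_ge:
  assumes "q \<ge> 0"
  shows "ennreal (4 * p\<^sup>2) \<le> ennreal ((q + p\<^sup>2)\<^sup>2) / ennreal q"
proof (cases "q = 0")
  case True
  then show ?thesis by auto
next
  case False
  then have q: "q > 0" using assms by simp
  have "4 * p\<^sup>2 * q \<le> (q + p\<^sup>2)\<^sup>2"
    using zero_le_power2[of "q - p\<^sup>2"] by (simp add: power2_sum power2_diff)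
  then show ?thesis
    using q by (simp add: divide_ennreal pos_le_divide_eq ennreal_leI)
qed

text \<open>Formally, the energy is at least \<open>4 \<integral> p\<^sup>2\<close> with \<open>p = \<theta>' + c\<close>, and the Cauchy-Schwarz inequality
  together with \<open>\<integral> p = \<theta> l - \<theta> 0 + c l\<close> gives the claim. To avoid integrating the weak derivative up
  to the endpoints, \<open>p\<^sup>2\<close> is bounded from below by its tangent \<open>2 s p - s\<^sup>2\<close> multiplied by a cutoff:
  this is linear in \<open>p\<close>, so the definition of the weak derivative applies to it directly.\<close>
lemma energy_lower_bound:
  assumes l: "l > 0" and \<theta>: "\<theta> \<in> W14 l" and \<tau>: "\<And>t. t \<in> {0..l} \<Longrightarrow> \<tau> t = c"
    and R: "energy l \<kappa> \<tau> \<theta> \<le> ennreal R" "R \<ge> 0"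
  shows "4 * (\<theta> l - \<theta> 0 + c * l)\<^sup>2 \<le> R * l"
proof -
  define g where "g = weak_deriv {0<..<l} \<theta>"
  define D where "D = \<theta> l - \<theta> 0 + c * l"
  \<comment> \<open>The mean value of \<open>p\<close>, at which the tangent bound is optimal (equality in Cauchy-Schwarz).\<close>
  define s where "s = D / l"
  let ?L = "lebesgue_on {0<..<l}" and ?\<phi> = "cutoff 0 l"
  have cont: "continuous_on {0..l} \<theta>" and g: "has_weak_deriv {0<..<l} \<theta> g"
    using \<theta> has_weak_deriv_weak_deriv unfolding g_def W14_def by blast+
  have \<phi>: "?\<phi> m \<in> test_functions {0<..<l}" for m by (rule cutoff_test_function)
  have const: "locally_integrable {0<..<l} (\<lambda>_. k)" for k
    by (intro locally_integrable_continuous continuous_intros)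
  have bound: "8 * s * (- (LINT t|?L. \<theta> t * deriv (?\<phi> m) t)) +
      (LINT t|?L. (8 * s * c - 4 * s\<^sup>2) * ?\<phi> m t) \<le> R" for m
  proof -
    have "8 * s * (- (LINT t|?L. \<theta> t * deriv (?\<phi> m) t)) + (LINT t|?L. (8 * s * c - 4 * s\<^sup>2) * ?\<phi> m t) =
        8 * s * (LINT t|?L. g t * ?\<phi> m t) + (LINT t|?L. (8 * s * c - 4 * s\<^sup>2) * ?\<phi> m t)"
      using g \<phi> by (simp add: has_weak_deriv_def)
    also have "\<dots> = (LINT t|?L. 8 * s * (g t * ?\<phi> m t) + (8 * s * c - 4 * s\<^sup>2) * ?\<phi> m t)"
    proof -
      have "integrable ?L (\<lambda>t. g t * ?\<phi> m t)" "integrable ?L (\<lambda>t. (8 * s * c - 4 * s\<^sup>2) * ?\<phi> m t)"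
        using g by (auto intro!: integrable_mult_test_function[OF _ \<phi>] const
            simp: has_weak_deriv_def simp del: integrable_mult_left_iff integrable_mult_right_iff)
      then show ?thesis by simp
    qed
    also have "\<dots> \<le> R"
    proof (rule integral_real_bounded[OF R(2)])
      have "(\<integral>\<^sup>+ t. ennreal (8 * s * (g t * ?\<phi> m t) + (8 * s * c - 4 * s\<^sup>2) * ?\<phi> m t) \<partial>?L)
          = (\<integral>\<^sup>+ t. ennreal (8 * s * (g t * ?\<phi> m t) + (8 * s * c - 4 * s\<^sup>2) * ?\<phi> m t) * indicator {0<..<l} t \<partial>lebesgue)"
        by (simp add: nn_integral_restrict_space)
      also have "\<dots> \<le> energy l \<kappa> \<tau> \<theta>"
        unfolding energy_def g_def[symmetric]
      proof (rule nn_integral_mono)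
        fix t
        let ?q = "(\<kappa> t)\<^sup>2 * (cos (\<theta> t))\<^sup>2" and ?p = "g t + \<tau> t"
        have "ennreal (8 * s * (g t * ?\<phi> m t) + (8 * s * c - 4 * s\<^sup>2) * ?\<phi> m t)
            \<le> ennreal ((?q + ?p\<^sup>2)\<^sup>2) / ennreal ?q" if t: "t \<in> {0<..<l}"
        proof -
          have c: "\<tau> t = c" using t by (intro \<tau>) auto
          have "8 * s * (g t * ?\<phi> m t) + (8 * s * c - 4 * s\<^sup>2) * ?\<phi> m t =
              ?\<phi> m t * (4 * ?p\<^sup>2 - 4 * (?p - s)\<^sup>2)"
            by (simp add: c power2_eq_square algebra_simps)
          also have "\<dots> \<le> ?\<phi> m t * (4 * ?p\<^sup>2)"
            using cutoff_bounds by (intro mult_left_mono) auto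
          also have "\<dots> \<le> 4 * ?p\<^sup>2"
            using cutoff_bounds by (intro mult_left_le_one_le) auto
          finally show ?thesis
            using energy_integrand_ge[of ?q ?p] by (meson ennreal_leI mult_nonneg_nonneg order_trans zero_le_power2)
        qed
        then show "ennreal (8 * s * (g t * ?\<phi> m t) + (8 * s * c - 4 * s\<^sup>2) * ?\<phi> m t) * indicator {0<..<l} t
            \<le> ennreal ((?q + ?p\<^sup>2)\<^sup>2) / ennreal ?q * indicator {0..l} t"
          by (auto simp: indicator_def)
      qed
      also have "\<dots> \<le> ennreal R" by (rule R(1))
      finally show "(\<integral>\<^sup>+ t. ennreal (8 * s * (g t * ?\<phi> m t) + (8 * s * c - 4 * s\<^sup>2) * ?\<phi> m t) \<partial>?L) \<le> ennreal R" .
    qed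
    finally show ?thesis .
  qed
  have "(\<lambda>m. LINT t|?L. (8 * s * c - 4 * s\<^sup>2) * ?\<phi> m t) \<longlonglongrightarrow> (LINT t|?L. 8 * s * c - 4 * s\<^sup>2)"
    by (intro LINT_mult_cutoff_tendsto lebesgue_on_open_interval continuous_intros)
  also have "(LINT t|?L. 8 * s * c - 4 * s\<^sup>2) = (8 * s * c - 4 * s\<^sup>2) * l"
    using l by (subst lebesgue_on_open_interval(2)) (auto simp: algebra_simps)
  finally have "(\<lambda>m. 8 * s * (- (LINT t|?L. \<theta> t * deriv (?\<phi> m) t)) +
      (LINT t|?L. (8 * s * c - 4 * s\<^sup>2) * ?\<phi> m t))
      \<longlonglongrightarrow> 8 * s * (- (\<theta> 0 - \<theta> l)) + (8 * s * c - 4 * s\<^sup>2) * l"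
    using l cont by (intro tendsto_intros cutoff_deriv_tendsto) auto
  then have "8 * s * (- (\<theta> 0 - \<theta> l)) + (8 * s * c - 4 * s\<^sup>2) * l \<le> R"
    by (rule LIMSEQ_le_const2) (use bound in blast)
  also have "8 * s * (- (\<theta> 0 - \<theta> l)) + (8 * s * c - 4 * s\<^sup>2) * l = 8 * s * D - 4 * s\<^sup>2 * l"
    by (simp add: D_def algebra_simps)
  also have "\<dots> = 4 * D\<^sup>2 / l"
    using l by (simp add: s_def power2_eq_square)
  finally show ?thesis
    using l by (simp add: D_def divide_le_eq)
qed

section \<open>Counting singular points\<close>

text \<open>A closed interval of length \<open>n \<pi>\<close> contains \<open>n\<close> consecutive points of the lattice
  \<open>\<pi>/2 + \<pi> \<int>\<close>, starting with the first one that is not below its left endpoint. By the intermediate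
  value theorem \<open>\<theta>\<close> attains each of them.\<close>
lemma many_singular_points:
  assumes "l \<ge> 0" and cont: "continuous_on {0..l} \<theta>" and var: "real n * pi \<le> \<bar>\<theta> l - \<theta> 0\<bar>"
  shows "\<exists>P\<subseteq>singular_points l \<theta>. finite P \<and> card P = n"
proof -
  define a where "a = min (\<theta> 0) (\<theta> l)"
  define k where "k = \<lceil>(a - pi / 2) / pi\<rceil>"
  define v where "v i = pi / 2 + pi * of_int (k + int i)" for i
  have "(a - pi / 2) / pi \<le> of_int k" "of_int k < (a - pi / 2) / pi + 1"
    unfolding k_def by linarith+
  then have k: "a \<le> pi / 2 + pi * of_int k" "pi * of_int k < a + pi / 2"
    by (simp_all add: field_simps)
  have "\<exists>t\<in>{0..l}. \<theta> t = v i" if "i < n" for i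
  proof -
    have "a \<le> v i" using k(1) mult_nonneg_nonneg[OF pi_ge_zero of_nat_0_le_iff[of i]]
      unfolding v_def of_int_add of_int_of_nat_eq distrib_left by linarith
    moreover have "v i \<le> max (\<theta> 0) (\<theta> l)"
    proof -
      have "real i + 1 \<le> real n" using that by simp
      from mult_right_mono[OF this, of pi]
      have "real i * pi + pi \<le> \<bar>\<theta> l - \<theta> 0\<bar>" using var by (simp add: algebra_simps)
      then show ?thesis using k(2) unfolding v_def a_def by (simp add: algebra_simps max_def min_def abs_if split: if_splits)
    qed
    moreover have "is_interval (\<theta> ` {0..l})"
      using cont by (simp add: is_interval_connected_1 connected_continuous_image)
    moreover have "\<theta> 0 \<in> \<theta> ` {0..l}" "\<theta> l \<in> \<theta> ` {0..l}"
      using \<open>l \<ge> 0\<close> by auto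
    ultimately have "v i \<in> \<theta> ` {0..l}"
      unfolding is_interval_1 a_def by (metis max_def min_def)
    then show ?thesis by auto
  qed
  then obtain t where t: "\<And>i. i < n \<Longrightarrow> t i \<in> {0..l}" "\<And>i. i < n \<Longrightarrow> \<theta> (t i) = v i"
    by metis
  have "inj_on t {..<n}"
  proof (rule inj_onI)
    fix i j assume "i \<in> {..<n}" "j \<in> {..<n}" "t i = t j"
    then have "v i = v j" using t(2) by (metis lessThan_iff)
    then show "i = j" by (simp add: v_def)
  qed
  moreover have "t ` {..<n} \<subseteq> singular_points l \<theta>"
    using t unfolding singular_points_def v_def by blast
  ultimately show ?thesis
    by (intro exI[of _ "t ` {..<n}"]) (simp add: card_image)
qed

lemma bounded_curvature:
  assumes "Ck_curve 3 l \<gamma>" and "t \<in> {0..l}"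
  shows "\<bar>curvature l \<gamma> t\<bar> \<le> (SUP s\<in>{0..l}. \<bar>curvature l \<gamma> s\<bar>)"
proof -
  have "(vderiv l ^^ 2) \<gamma> differentiable_on {0..l}"
    using assms(1) by (simp add: Ck_curve_def)
  then have "continuous_on {0..l} (vderiv l (vderiv l \<gamma>))"
    by (simp add: numeral_2_eq_2 differentiable_imp_continuous_on)
  then have "continuous_on {0..l} (\<lambda>s. \<bar>curvature l \<gamma> s\<bar>)"
    unfolding curvature_def by (intro continuous_intros)
  then have "bdd_above ((\<lambda>s. \<bar>curvature l \<gamma> s\<bar>) ` {0..l})"
    by (intro bounded_imp_bdd_above compact_imp_bounded compact_continuous_image) auto
  then show ?thesis
    using assms(2) by (rule cSUP_upper[rotated])
qed

theorem theorem1p4: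
  fixes l :: real and \<gamma> :: "real \<Rightarrow> real^3" and n :: nat and \<theta>min :: "real \<Rightarrow> real"
  assumes "l > 0"
    and "Ck_curve 3 l \<gamma>"
    and "unit_speed l \<gamma>"
    and "\<forall>t\<in>{0..l}. curvature l \<gamma> t > 0"
    and "torsion l \<gamma> constant_on {0..l}"
    and "\<forall>t\<in>{0..l}. \<bar>torsion l \<gamma> t\<bar> > real n * (pi / l) + (SUP s\<in>{0..l}. \<bar>curvature l \<gamma> s\<bar>)"
    and "is_minimizer l (energy l (curvature l \<gamma>) (torsion l \<gamma>)) \<theta>min"
  shows "\<exists>P \<subseteq> singular_points l \<theta>min. finite P \<and> card P = n"
proof -
  define K where "K = (SUP s\<in>{0..l}. \<bar>curvature l \<gamma> s\<bar>)"
  have \<kappa>: "\<bar>curvature l \<gamma> t\<bar> \<le> K" if "t \<in> {0..l}" for t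
    unfolding K_def by (rule bounded_curvature[OF assms(2) that])
  have zero: "0 \<in> {0..l}" using \<open>l > 0\<close> by simp
  have K: "K \<ge> 0" using \<kappa>[OF zero] by linarith
  obtain c where \<tau>: "torsion l \<gamma> t = c" if "t \<in> {0..l}" for t
    using assms(5) unfolding constant_on_def by blast
  define D where "D = \<theta>min l - \<theta>min 0 + c * l"
  have "real n * (pi / l) + K < \<bar>c\<bar>"
    using assms(6) zero \<tau> unfolding K_def by metis
  then have "(real n * (pi / l) + K) * l < \<bar>c\<bar> * l"
    using \<open>l > 0\<close> by (rule mult_strict_right_mono)
  then have large: "real n * pi + K * l < \<bar>c * l\<bar>"
    using \<open>l > 0\<close> by (simp add: algebra_simps abs_mult)
  have min: "\<theta>min \<in> W14 l"
    "\<And>\<phi>. \<phi> \<in> W14 l \<Longrightarrow> energy l (curvature l \<gamma>) (torsion l \<gamma>) \<theta>min \<le> energy l (curvature l \<gamma>) (torsion l \<gamma>) \<phi>"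
    using assms(7) by (auto simp: is_minimizer_def)
  have "energy l (curvature l \<gamma>) (torsion l \<gamma>) \<theta>min \<le> ennreal (K\<^sup>2 * l)"
    using min(2)[OF linear_in_W14(2)[OF \<open>l > 0\<close>]] energy_linear_le[OF \<open>l > 0\<close> \<kappa> \<tau>]
    by (rule order_trans)
  then have "4 * D\<^sup>2 \<le> K\<^sup>2 * l * l"
    using \<open>l > 0\<close> unfolding D_def by (intro energy_lower_bound[OF \<open>l > 0\<close> min(1) \<tau>]) auto
  then have "(2 * D)\<^sup>2 \<le> (K * l)\<^sup>2"
    unfolding power_mult_distrib by (simp add: power2_eq_square mult_ac)
  moreover have "0 \<le> K * l" using K \<open>l > 0\<close> by simp
  ultimately have "2 * \<bar>D\<bar> \<le> K * l"
    using power2_le_imp_le[of "2 * \<bar>D\<bar>" "K * l"] by simp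
  then have "\<bar>D\<bar> \<le> K * l" using \<open>0 \<le> K * l\<close> by simp
  moreover have "\<bar>c * l\<bar> \<le> \<bar>D\<bar> + \<bar>\<theta>min l - \<theta>min 0\<bar>"
    unfolding D_def by linarith
  ultimately have "real n * pi \<le> \<bar>\<theta>min l - \<theta>min 0\<bar>"
    using large by linarith
  then show ?thesis
    using \<open>l > 0\<close> min(1) by (intro many_singular_points) (auto simp: W14_def)
qed

end
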